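(* Let $\mathbb{K} \subset \mathbb{V}$ be a cone, let $\mathbb{J}\subset\mathbb{V}$ be a cone, and let $H^0, Q^0 \in \mathbb{V}$. Assume: Condition 0$_{\rm J}$: $\mathbb{J}$ is a face of $\mathrm{co}\,\mathbb{K}$; Condition I$_{\rm J}$: $G(\mathbb{K}\cap\mathbb{J},1)\neq\emptyset$ and $0\neq H^0\in\mathbb{J}^*$. Then: (i) $G(\mathbb{J},1) = \mathrm{co}\,G(\mathbb{K}\cap\mathbb{J},1) + \mathrm{co}\,G(\mathbb{K}\cap\mathbb{J},0)$ (Minkowski sum). (ii) $\zeta(\mathbb{J},Q^0,1) = \zeta(\mathbb{K}\cap\mathbb{J},Q^0,1) + \zeta(\mathbb{K}\cap\mathbb{J},Q^0,0)$. (iii) $\zeta(\mathbb{J},Q^0,1) = \zeta(\mathbb{K}\cap\mathbb{J},Q^0,1)$ if and only if at least one of the following holds: Condition II$_{\rm J}$, i.e. $\zeta(\mathbb{K}\cap\mathbb{J},Q^0,0)\ge 0$; or $\zeta(\mathbb{K}\cap\mathbb{J},Q^0,1)=-\infty$.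
   Context: $\mathbb{V}$ is a finite-dimensional real vector space with inner product $\langle\cdot,\cdot\rangle$. A set $\mathbb{K}\subset\mathbb{V}$ is a cone (not necessarily convex or closed) if $\lambda A\in\mathbb{K}$ for every $A\in\mathbb{K}$ and every $\lambda\ge 0$. $\mathrm{co}$ denotes the convex hull. The dual of a cone $\mathbb{K}$ is $\mathbb{K}^*=\{Y\in\mathbb{V}:\langle Y,X\rangle\ge 0 \text{ for every } X\in\mathbb{K}\}$. A convex cone $\mathbb{J}\subset\mathbb{C}$ is a face of a convex cone $\mathbb{C}$ if $X^1,X^2\in\mathbb{J}$ whenever $X^1,X^2\in\mathbb{C}$ and $X^1/2+X^2/2\in\mathbb{J}$ (the face $\mathbb{J}=\mathbb{C}$ is allowed). With $H^0\in\mathbb{V}$ fixed, for a cone $\mathbb{K}\subset\mathbb{V}$, $P\in\mathbb{V}$ and $\rho\ge 0$, define $G(\mathbb{K},\rho)=\{X\in\mathbb{K}:\langle H^0,X\rangle=\rho\}$ and $\zeta(\mathbb{K},P,\rho)=\inf\{\langle P,X\rangle: X\in G(\mathbb{K},\rho)\}$, an extended real number, with $\zeta(\mathbb{K},P,\rho)=+\infty$ if $G(\mathbb{K},\rho)=\emptyset$. *)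

theory Defs
  imports "HOL-Analysis.Analysis"
begin

definition dual_cone :: "'a::real_inner set \<Rightarrow> 'a set" where
  "dual_cone K = {Y. \<forall>X\<in>K. Y \<bullet> X \<ge> 0}"

(* The midpoint form of the face condition; the ambient C is meant to be a convex cone.
   For cones it agrees with the library's face_of, see cone_face_iff_face_of below. *)
definition cone_face :: "'a::real_vector set \<Rightarrow> 'a set \<Rightarrow> bool" where
  "cone_face J C \<longleftrightarrow> convex J \<and> cone J \<and> J \<subseteq> C \<and>
     (\<forall>X1\<in>C. \<forall>X2\<in>C. X1 /\<^sub>R 2 + X2 /\<^sub>R 2 \<in> J \<longrightarrow> X1 \<in> J \<and> X2 \<in> J)"

definition G :: "'a::real_inner \<Rightarrow> 'a set \<Rightarrow> real \<Rightarrow> 'a set" where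
  "G H0 K \<rho> = {X \<in> K. H0 \<bullet> X = \<rho>}"

(* Extended-real infimum: it equals \<infinity> when G H0 K \<rho> is empty, see zeta_empty. *)
definition zeta :: "'a::real_inner \<Rightarrow> 'a set \<Rightarrow> 'a \<Rightarrow> real \<Rightarrow> ereal" where
  "zeta H0 K P \<rho> = (INF X\<in>G H0 K \<rho>. ereal (P \<bullet> X))"

lemma zeta_empty: "G H0 K \<rho> = {} \<Longrightarrow> zeta H0 K P \<rho> = \<infinity>"
  by (simp add: zeta_def top_ereal_def)

lemma cone_face_iff_face_of:
  assumes C: "cone C" and J: "cone J"
  shows "cone_face J C \<longleftrightarrow> J face_of C"
proof
  assume L: "cone_face J C"
  have "a \<in> J \<and> b \<in> J"
    if ab: "a \<in> C" "b \<in> C" and x: "x \<in> J" "x \<in> open_segment a b" for a b x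
  proof -
    obtain u where u: "0 < u" "u < 1" "x = (1 - u) *\<^sub>R a + u *\<^sub>R b"
      using x(2) by (auto simp: in_segment)
    have "(2 * (1 - u)) *\<^sub>R a \<in> C" "(2 * u) *\<^sub>R b \<in> C"
      using C ab u by (auto simp: cone_def)
    moreover have "((2 * (1 - u)) *\<^sub>R a) /\<^sub>R 2 + ((2 * u) *\<^sub>R b) /\<^sub>R 2 \<in> J"
      using x(1) u(3) by (simp add: diff_divide_distrib)
    ultimately have in_J: "(2 * (1 - u)) *\<^sub>R a \<in> J" "(2 * u) *\<^sub>R b \<in> J"
      using L unfolding cone_face_def by blast+
    have "(1 / (2 * (1 - u))) *\<^sub>R ((2 * (1 - u)) *\<^sub>R a) \<in> J"
         "(1 / (2 * u)) *\<^sub>R ((2 * u) *\<^sub>R b) \<in> J"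
      using u by (intro mem_cone[OF J] in_J; simp)+
    then show ?thesis using u by simp
  qed
  then show "J face_of C"
    using L unfolding cone_face_def face_of_def by blast
next
  assume R: "J face_of C"
  have "X1 \<in> J \<and> X2 \<in> J"
    if X: "X1 \<in> C" "X2 \<in> C" and mid: "X1 /\<^sub>R 2 + X2 /\<^sub>R 2 \<in> J" for X1 X2
  proof (cases "X1 = X2")
    case True
    have "X2 /\<^sub>R 2 + X2 /\<^sub>R 2 = X2"
      by (simp flip: scaleR_add_left)
    then show ?thesis using mid True by simp
  next
    case False
    have "X1 /\<^sub>R 2 + X2 /\<^sub>R 2 = midpoint X1 X2"
      by (simp add: midpoint_def scaleR_add_right)
    with False have "X1 /\<^sub>R 2 + X2 /\<^sub>R 2 \<in> open_segment X1 X2" by simp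
    then show ?thesis using R X mid unfolding face_of_def by blast
  qed
  then show "cone_face J C"
    using R J unfolding cone_face_def face_of_def by blast
qed

end

theory Submission
  imports Defs
begin

text \<open>
  A face \<open>J\<close> of \<open>co K\<close> is the convex hull of \<open>L = K \<inter> J\<close>. A point of \<open>L\<close> is either a positive
  multiple of a point of \<open>G(L,1)\<close> or a point of \<open>G(L,0)\<close>, so the convex set
  \<open>cone (co G(L,1)) + co G(L,0)\<close> contains \<open>L\<close>, hence \<open>J\<close>; the slice \<open>\<langle>H\<^sup>0, X\<rangle> = 1\<close> forces the scalar
  in the first summand to be \<open>1\<close>. The values then follow because the infimum of a linear form
  does not change under convex hulls and is additive over Minkowski sums.
\<close>

text \<open>The face property pulls membership in \<open>J\<close> back from a proper convex
  combination to its endpoints. Hence the points of \<open>convex hull K\<close> that satisfy the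
  claimed inclusion form a convex set containing \<open>K\<close>, which is all of
  \<open>convex hull K\<close>.\<close>

lemma face_of_convex_hull_eq:
  assumes "J face_of convex hull K"
  shows "J = convex hull (K \<inter> J)"
proof
  show "convex hull (K \<inter> J) \<subseteq> J"
    using face_of_imp_convex[OF assms] by (simp add: hull_minimal)
  define P where "P = {x \<in> convex hull K. x \<in> J \<longrightarrow> x \<in> convex hull (K \<inter> J)}"
  have "convex P"
  proof (rule convexI)
    fix x y and u v :: real
    assume xy: "x \<in> P" "y \<in> P" and uv: "0 \<le> u" "0 \<le> v" "u + v = 1"
    show "u *\<^sub>R x + v *\<^sub>R y \<in> P"
    \<comment> \<open>An open segment needs distinct endpoints and positive weights; otherwise the
      combination is just \<open>x\<close> or \<open>y\<close>.\<close>
    proof (cases "x = y \<or> u = 0 \<or> v = 0")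
      case True
      then show ?thesis using xy uv by (auto simp flip: scaleR_add_left)
    next
      case False
      have "u = 1 - v" using uv by simp
      then have seg: "u *\<^sub>R x + v *\<^sub>R y \<in> open_segment x y"
        using False uv by (auto simp: in_segment intro!: exI[of _ v])
      have "u *\<^sub>R x + v *\<^sub>R y \<in> convex hull K"
        using xy uv convexD[OF convex_convex_hull] unfolding P_def by blast
      moreover have "u *\<^sub>R x + v *\<^sub>R y \<in> convex hull (K \<inter> J)" if "u *\<^sub>R x + v *\<^sub>R y \<in> J"
      proof -
        have "x \<in> J" "y \<in> J"
          using assms that seg xy unfolding face_of_def P_def by blast+
        then show ?thesis
          using xy uv convexD[OF convex_convex_hull] unfolding P_def by blast
      qed
      ultimately show ?thesis by (simp add: P_def)
    qed
  qed
  then have "convex hull K \<subseteq> P"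
    by (intro hull_minimal) (auto simp: P_def hull_inc)
  then show "J \<subseteq> convex hull (K \<inter> J)"
    using face_of_imp_subset[OF assms] unfolding P_def by blast
qed

text \<open>For finite \<open>c\<close> this is a half-space; for infinite \<open>c\<close> it is
  empty or the whole space. An extended bound lets the next lemma treat unbounded and empty problems
  uniformly.\<close>

lemma convex_ereal_inner_ge:
  "convex {X. c \<le> ereal (Q \<bullet> X)}"
  by (cases c) (simp_all add: convex_halfspace_ge)

lemma INF_ereal_inner_convex_hull:
  "(INF X\<in>convex hull S. ereal (Q \<bullet> X)) = (INF X\<in>S. ereal (Q \<bullet> X))" (is "_ = ?c")
proof (rule antisym)
  show "(INF X\<in>convex hull S. ereal (Q \<bullet> X)) \<le> ?c"
    by (intro INF_superset_mono hull_subset order_refl)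
  have "convex hull S \<subseteq> {X. ?c \<le> ereal (Q \<bullet> X)}"
    by (intro hull_minimal convex_ereal_inner_ge) (auto intro: INF_lower)
  then show "?c \<le> (INF X\<in>convex hull S. ereal (Q \<bullet> X))"
    by (auto intro!: INF_greatest)
qed

text \<open>Nonempty sets keep both infima below \<infinity>, so the sum on the right is never of
  the form \<infinity> - \<infinity>. For the harder inequality, one summand is fixed while the
  other varies.\<close>

lemma INF_ereal_inner_set_plus:
  assumes "S \<noteq> {}" "T \<noteq> {}"
  shows "(INF X\<in>S + T. ereal (Q \<bullet> X)) = (INF X\<in>S. ereal (Q \<bullet> X)) + (INF X\<in>T. ereal (Q \<bullet> X))"
    (is "?l = ?s + ?t")
proof (rule antisym)
  have fin: "?t \<noteq> \<infinity>"
  proof -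
    obtain y where "y \<in> T" using assms by blast
    then have "?t \<le> ereal (Q \<bullet> y)" by (rule INF_lower)
    then show ?thesis by auto
  qed
  show "?s + ?t \<le> ?l"
  proof (rule INF_greatest)
    fix X assume "X \<in> S + T"
    then obtain x y where X: "X = x + y" "x \<in> S" "y \<in> T" by (rule set_plus_elim)
    then have "?s + ?t \<le> ereal (Q \<bullet> x) + ereal (Q \<bullet> y)"
      by (intro add_mono INF_lower)
    then show "?s + ?t \<le> ereal (Q \<bullet> X)" by (simp add: X inner_add_right)
  qed
  show "?l \<le> ?s + ?t"
  proof -
    have 1: "?l - ereal (Q \<bullet> x) \<le> ?t" if "x \<in> S" for x
    proof (rule INF_greatest)
      fix y assume "y \<in> T"
      with that have "?l \<le> ereal (Q \<bullet> (x + y))" by (intro INF_lower set_plus_intro)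
      then show "?l - ereal (Q \<bullet> x) \<le> ereal (Q \<bullet> y)"
        by (cases ?l) (auto simp: inner_add_right)
    qed
    show ?thesis
    \<comment> \<open>A finite \<open>?t\<close> can be moved to the other side, giving a lower
      bound over \<open>S\<close>. If it is -\<infinity>, a single \<open>x\<close> already forces
      \<open>?l\<close> down to -\<infinity>.\<close>
    proof (cases "?t = -\<infinity>")
      case True
      obtain x where "x \<in> S" using assms by blast
      from 1[OF this] True have "?l = -\<infinity>" by (cases ?l) auto
      then show ?thesis by simp
    next
      case False
      with fin obtain t where t: "?t = ereal t" by (cases ?t) auto
      have "?l - ereal t \<le> ?s"
      proof (rule INF_greatest)
        fix x assume "x \<in> S"
        from 1[OF this] show "?l - ereal t \<le> ereal (Q \<bullet> x)"
          unfolding t by (cases ?l) auto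
      qed
      then show ?thesis
        unfolding t by (simp add: ereal_minus_le)
    qed
  qed
qed

lemma slice_convex_hull_cone:
  fixes L :: "'a::real_inner set"
  assumes L: "cone L" and G1: "G H L 1 \<noteq> {}" and pos: "\<And>X. X \<in> L \<Longrightarrow> 0 \<le> H \<bullet> X"
  shows "G H (convex hull L) 1 = convex hull (G H L 1) + convex hull (G H L 0)"
proof
  \<comment> \<open>A slice lies in a hyperplane, and its hull cannot leave that hyperplane.\<close>
  have sub: "convex hull (G H L \<rho>) \<subseteq> G H (convex hull L) \<rho>" for \<rho>
  proof -
    have "convex (convex hull L \<inter> {X. H \<bullet> X = \<rho>})"
      by (intro convex_Int convex_convex_hull convex_hyperplane)
    moreover have "G H (convex hull L) \<rho> = convex hull L \<inter> {X. H \<bullet> X = \<rho>}"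
      by (auto simp: G_def)
    ultimately have "convex (G H (convex hull L) \<rho>)" by simp
    then show ?thesis by (intro hull_minimal) (auto simp: G_def hull_inc)
  qed
  have "cone (convex hull L)" using L by (rule cone_convex_hull)
  then have add: "x + y \<in> convex hull L" if "x \<in> convex hull L" "y \<in> convex hull L" for x y
    using that convex_cone[of "convex hull L"] convex_convex_hull by blast
  show "convex hull (G H L 1) + convex hull (G H L 0) \<subseteq> G H (convex hull L) 1"
    using sub[of 1] sub[of 0]
    by (fastforce elim!: set_plus_elim simp: G_def inner_add_right intro: add)
  \<comment> \<open>Only the first summand needs scaling, since \<open>G H L 0\<close> is already a
    cone.\<close>
  define S where "S = cone hull (convex hull (G H L 1)) + convex hull (G H L 0)"
  obtain Z where Z: "Z \<in> G H L 1" using G1 by blast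
  have zero: "0 \<in> G H L 0"
    using Z mem_cone[OF L, of Z 0] by (simp add: G_def)
  have "L \<subseteq> S"
  proof
    fix X assume X: "X \<in> L"
    show "X \<in> S"
    proof (cases "H \<bullet> X = 0")
      case True
      have "0 \<in> cone hull (convex hull (G H L 1))"
        using Z by (intro cone_hull_contains_0[THEN iffD1]) auto
      moreover have "X \<in> convex hull (G H L 0)"
        using True X by (simp add: G_def hull_inc)
      ultimately have "0 + X \<in> S" unfolding S_def by (rule set_plus_intro)
      then show ?thesis by simp
    next
      case False
      with pos[OF X] have t: "H \<bullet> X > 0" by simp
      then have "(1 / (H \<bullet> X)) *\<^sub>R X \<in> G H L 1"
        using X L by (simp add: G_def mem_cone)
      then have "(H \<bullet> X) *\<^sub>R ((1 / (H \<bullet> X)) *\<^sub>R X) \<in> cone hull (convex hull (G H L 1))"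
        using t by (intro mem_cone[OF cone_cone_hull hull_inc] hull_inc) simp_all
      then have "X + 0 \<in> S"
        unfolding S_def using t zero by (intro set_plus_intro) (simp_all add: hull_inc)
      then show ?thesis by simp
    qed
  qed
  moreover have "convex S"
    unfolding S_def by (intro convex_set_plus convex_cone_hull convex_convex_hull)
  ultimately have hull: "convex hull L \<subseteq> S" by (rule hull_minimal)
  show "G H (convex hull L) 1 \<subseteq> convex hull (G H L 1) + convex hull (G H L 0)"
  proof
    fix X assume X: "X \<in> G H (convex hull L) 1"
    with hull have "X \<in> S" by (auto simp: G_def)
    then obtain c A B where *: "X = c *\<^sub>R A + B" "A \<in> convex hull (G H L 1)"
        "B \<in> convex hull (G H L 0)"
      unfolding S_def cone_hull_expl by (auto elim!: set_plus_elim)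
    have "H \<bullet> X = 1" "H \<bullet> A = 1" "H \<bullet> B = 0"
      using X * sub[of 1] sub[of 0] by (auto simp: G_def)
    then have "c = 1" using *(1) by (simp add: inner_add_right)
    then show "X \<in> convex hull (G H L 1) + convex hull (G H L 0)"
      using * by auto
  qed
qed

theorem theorem3p6:
  fixes K J :: "'v::euclidean_space set" and H0 Q0 :: 'v
  assumes "cone K"
    and "cone J"
    and cond_0: "cone_face J (convex hull K)"
    and cond_I: "G H0 (K \<inter> J) 1 \<noteq> {}" "H0 \<noteq> 0" "H0 \<in> dual_cone J"
  shows "G H0 J 1 = convex hull (G H0 (K \<inter> J) 1) + convex hull (G H0 (K \<inter> J) 0)
    \<and> zeta H0 J Q0 1 = zeta H0 (K \<inter> J) Q0 1 + zeta H0 (K \<inter> J) Q0 0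
    \<and> (zeta H0 J Q0 1 = zeta H0 (K \<inter> J) Q0 1 \<longleftrightarrow>
        zeta H0 (K \<inter> J) Q0 0 \<ge> 0 \<or> zeta H0 (K \<inter> J) Q0 1 = -\<infinity>)"
proof -
  have "J face_of convex hull K"
    using cond_0 cone_face_iff_face_of[OF cone_convex_hull[OF \<open>cone K\<close>] \<open>cone J\<close>] by simp
  then have J: "convex hull (K \<inter> J) = J" by (rule face_of_convex_hull_eq[symmetric])
  have cone: "cone (K \<inter> J)"
    using \<open>cone K\<close> \<open>cone J\<close> by (auto simp: cone_def)
  have slice: "G H0 J 1 = convex hull (G H0 (K \<inter> J) 1) + convex hull (G H0 (K \<inter> J) 0)"
    \<comment> \<open>Membership of \<open>H0\<close> in the dual of \<open>J\<close> supplies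
      nonnegativity on \<open>K \<inter> J\<close>.\<close>
    using slice_convex_hull_cone[OF cone cond_I(1)] cond_I(3)
    unfolding J by (simp add: dual_cone_def)
  obtain Z where Z: "Z \<in> G H0 (K \<inter> J) 1" using cond_I(1) by blast
  then have zero: "0 \<in> G H0 (K \<inter> J) 0"
    using mem_cone[OF cone, of Z 0] by (simp add: G_def)
  have sum: "zeta H0 J Q0 1 = zeta H0 (K \<inter> J) Q0 1 + zeta H0 (K \<inter> J) Q0 0"
    unfolding zeta_def slice using Z zero
    by (subst INF_ereal_inner_set_plus) (auto simp: INF_ereal_inner_convex_hull)
  \<comment> \<open>The origin is feasible at level 0. What remains is arithmetic: for a <
    \<infinity> and b \<le> 0, a + b = a exactly when b = 0 or a = -\<infinity>.\<close>
  have "zeta H0 (K \<inter> J) Q0 0 \<le> 0"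
    unfolding zeta_def using INF_lower[OF zero, of "\<lambda>X. ereal (Q0 \<bullet> X)"] by (simp add: zero_ereal_def)
  moreover have "zeta H0 (K \<inter> J) Q0 1 \<noteq> \<infinity>"
    unfolding zeta_def using INF_lower[OF Z, of "\<lambda>X. ereal (Q0 \<bullet> X)"] by auto
  ultimately have "zeta H0 (K \<inter> J) Q0 1 + zeta H0 (K \<inter> J) Q0 0 = zeta H0 (K \<inter> J) Q0 1 \<longleftrightarrow>
      zeta H0 (K \<inter> J) Q0 0 \<ge> 0 \<or> zeta H0 (K \<inter> J) Q0 1 = -\<infinity>"
    by (cases "zeta H0 (K \<inter> J) Q0 1"; cases "zeta H0 (K \<inter> J) Q0 0") auto
  with slice sum show ?thesis by simp
qed

end
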